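(* Let $f:H\to\mathbb{R}$ be $\mu$-strongly convex and $L$-smooth ($\mu,L>0$), with minimizer $x^*$ and minimum value $f^*$. Pick $m\in[1,2]$ and set $$h=\frac{1}{\sqrt L},\qquad \alpha=2\sqrt{\mu m},\qquad \gamma=m+\alpha h.$$ Given $x_0,y_0\in H$, let $(x_k)$ and $(y_k)$ be generated, for $k\ge 0$, by $$y_{k+1}=x_k-h^2\nabla f(x_k),\qquad x_{k+1}=y_{k+1}+\frac{1}{1+\alpha h}(y_{k+1}-y_k)+\left(\frac{\gamma}{1+\alpha h}-1\right)(y_{k+1}-x_k).$$ If $y_0=-\left(\gamma-\frac12\alpha h\right)h^2\nabla f(x_0)+x_0$, then for every $k\ge 1$, $$f(y_k)-f^*\le\left[\frac{\mu}{2}\|x_0-x^*\|^2+\left(f(x_0)-f^*\right)\right](1+\rho)^{-k+1},$$ where $\rho=\sqrt{qm}$ and $q=\mu/L$. Moreover, $\sum_{k=0}^\infty(1+\rho)^k\|\nabla f(x_k)\|^2<\infty$. In particular, $\|\nabla f(x_k)\|^2=o\big((1+\rho)^{-k}\big)$ as $k\to\infty$.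
   Context: $H$ is a real Hilbert space with inner product $\langle\cdot,\cdot\rangle$ and norm $\|\cdot\|$. $f$ is $L$-smooth if it is differentiable and $\nabla f$ is Lipschitz-continuous with constant $L$. A differentiable $f$ is $\mu$-strongly convex if $f(y)\ge f(x)+\langle\nabla f(x),y-x\rangle+\frac{\mu}{2}\|x-y\|^2$ for all $x,y\in H$. *)

theory Defs
  imports "HOL-Analysis.Analysis" "HOL-Library.Landau_Symbols"
begin

definition grad :: "('a::real_inner \<Rightarrow> real) \<Rightarrow> 'a \<Rightarrow> 'a" where
  "grad f x = (THE g. GDERIV f x :> g)"

definition L_smooth :: "real \<Rightarrow> ('a::real_inner \<Rightarrow> real) \<Rightarrow> bool" where
  "L_smooth L f \<longleftrightarrow> (\<forall>x. f differentiable (at x)) \<and> L-lipschitz_on UNIV (grad f)"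

definition strongly_convex :: "real \<Rightarrow> ('a::real_inner \<Rightarrow> real) \<Rightarrow> bool" where
  "strongly_convex \<mu> f \<longleftrightarrow> (\<forall>x. f differentiable (at x)) \<and>
     (\<forall>x y. f y \<ge> f x + grad f x \<bullet> (y - x) + \<mu> / 2 * (norm (x - y))\<^sup>2)"

text \<open>
  On a Hilbert space, Frechet differentiability guarantees that the description operator in
  \<^const>\<open>grad\<close> picks out an actual gradient. This is the Riesz representation theorem, proved here
  by minimizing \<open>norm x ^ 2 / 2 - \<phi> x\<close>.
\<close>

lemma riesz_representation:
  fixes \<phi> :: "'a::{real_inner, complete_space} \<Rightarrow> real"
  assumes "bounded_linear \<phi>"
  shows "\<exists>u. \<forall>v. \<phi> v = v \<bullet> u"
proof -
  interpret bounded_linear \<phi> by fact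
  define J where "J = (\<lambda>x. (x \<bullet> x) / 2 - \<phi> x)"
  define d where "d = Inf (range J)"
  obtain K where K: "\<And>x. norm (\<phi> x) \<le> norm x * K"
    using bounded by blast
  have lb: "- (K\<^sup>2 / 2) \<le> J x" for x
  proof -
    have "0 \<le> (norm x - K)\<^sup>2" by simp
    moreover have "\<phi> x \<le> norm x * K" using K[of x] by simp
    ultimately show ?thesis
      by (simp add: J_def power2_diff flip: power2_norm_eq_inner)
  qed
  have bdd: "bdd_below (range J)" using lb by (auto intro!: bdd_belowI)
  have dJ: "d \<le> J x" for x unfolding d_def using bdd by (auto intro: cInf_lower)
  have "\<exists>x. J x < d + inverse (real (Suc n))" for n
    using cInf_lessD[of "range J" "d + inverse (real (Suc n))"] by (auto simp: d_def)
  then obtain u where u: "\<And>n. J (u n) < d + inverse (real (Suc n))" by metis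
  have par: "J x + J y - 2 * J ((1/2) *\<^sub>R (x + y)) = (dist x y)\<^sup>2 / 4" for x y
    by (simp add: J_def dist_norm power2_norm_eq_inner scaleR add algebra_simps inner_commute)
  define \<epsilon> :: "nat \<Rightarrow> real" where "\<epsilon> = (\<lambda>n. inverse (real (Suc n)))"
  have u\<epsilon>: "J (u n) < d + \<epsilon> n" for n using u by (simp add: \<epsilon>_def)
  have d2: "(dist (u m) (u n))\<^sup>2 \<le> 4 * (\<epsilon> m + \<epsilon> n)" for m n
    using par[of "u m" "u n"] u\<epsilon>[of m] u\<epsilon>[of n] dJ[of "(1/2) *\<^sub>R (u m + u n)"] by argo
  have "Cauchy u"
  proof (rule metric_CauchyI)
    fix e :: real assume e: "e > 0"
    then obtain N where N: "\<epsilon> N < e\<^sup>2 / 8"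
      using reals_Archimedean[of "e\<^sup>2 / 8"] by (auto simp: \<epsilon>_def)
    have "dist (u m) (u n) < e" if "m \<ge> N" "n \<ge> N" for m n
    proof -
      have "\<epsilon> m \<le> \<epsilon> N" "\<epsilon> n \<le> \<epsilon> N"
        using that by (auto simp: \<epsilon>_def intro!: le_imp_inverse_le)
      then have "(dist (u m) (u n))\<^sup>2 < e\<^sup>2" using d2[of m n] N by argo
      then show ?thesis using e by (simp add: power_less_imp_less_base)
    qed
    then show "\<exists>N. \<forall>m\<ge>N. \<forall>n\<ge>N. dist (u m) (u n) < e" by blast
  qed
  then obtain w where w: "u \<longlonglongrightarrow> w"
    by (auto simp: Cauchy_convergent_iff convergent_def)
  have "(\<lambda>n. J (u n)) \<longlonglongrightarrow> J w"
    unfolding J_def by (intro tendsto_intros w tendsto) simp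
  moreover have "(\<lambda>n. d + inverse (real (Suc n))) \<longlonglongrightarrow> d + 0"
    by (intro tendsto_intros LIMSEQ_inverse_real_of_nat)
  ultimately have "J w \<le> d + 0"
    by (rule LIMSEQ_le) (use u in \<open>auto intro: less_imp_le\<close>)
  then have min: "J w \<le> J x" for x using dJ[of x] by simp
  have "\<phi> v = v \<bullet> w" for v
  proof (cases "v = 0")
    case False
    define c where "c = v \<bullet> w - \<phi> v"
    define t where "t = - c / (v \<bullet> v)"
    have vv: "v \<bullet> v > 0" using False by simp
    have "J (w + t *\<^sub>R v) - J w = t * c + t\<^sup>2 * (v \<bullet> v) / 2"
      by (simp add: J_def c_def add scaleR algebra_simps inner_commute power2_eq_square
          add_divide_distrib)
    also have "\<dots> = - (c\<^sup>2 / (2 * (v \<bullet> v)))"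
      using vv by (simp add: t_def field_simps power2_eq_square)
    finally have "c\<^sup>2 / (2 * (v \<bullet> v)) \<le> 0" using min[of "w + t *\<^sub>R v"] by linarith
    then have "c = 0" using vv by (simp add: divide_le_0_iff)
    then show ?thesis by (simp add: c_def)
  qed (simp add: zero)
  then show ?thesis by blast
qed

lemma GDERIV_unique:
  assumes "GDERIV f x :> g" "GDERIV f x :> g'"
  shows "g = g'"
proof -
  have "(\<lambda>h. h \<bullet> g) = (\<lambda>h. h \<bullet> g')"
    using assms unfolding gderiv_def by (rule has_derivative_unique)
  then have "(g - g') \<bullet> g = (g - g') \<bullet> g'" by metis
  then have "(g - g') \<bullet> (g - g') = 0" by (simp add: inner_diff_right)
  then show ?thesis by simp
qed

lemma grad_eqI: "GDERIV f x :> g \<Longrightarrow> grad f x = g"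
  unfolding grad_def by (blast intro: GDERIV_unique)

lemma GDERIV_grad:
  fixes f :: "'a::{real_inner, complete_space} \<Rightarrow> real"
  assumes "f differentiable (at x)"
  shows "GDERIV f x :> grad f x"
proof -
  obtain D where D: "(f has_derivative D) (at x)"
    using assms by (auto simp: differentiable_def)
  obtain u where "\<forall>v. D v = v \<bullet> u"
    using riesz_representation[OF has_derivative_bounded_linear[OF D]] by blast
  then have "D = (\<lambda>v. v \<bullet> u)" by auto
  with D have "GDERIV f x :> u" by (simp add: gderiv_def)
  then show ?thesis by (simp add: grad_eqI)
qed

end

theory Submission
  imports Defs
begin

text \<open>
  Since \<open>\<alpha> h = 2 \<rho>\<close>, the iteration is a coupling with a third sequence
  \<open>z\<^sub>k = x\<^sub>k + (x\<^sub>k - y\<^sub>k - (m + \<rho>) h\<^sup>2 \<nabla>f(x\<^sub>k)) / \<rho>\<close>: one has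
  \<open>(1 + \<rho>) (x\<^sub>k\<^sub>+\<^sub>1 - y\<^sub>k\<^sub>+\<^sub>1) = \<rho> (z\<^sub>k - x\<^sub>k\<^sub>+\<^sub>1)\<close> and
  \<open>(1 + \<rho>) z\<^sub>k\<^sub>+\<^sub>1 = z\<^sub>k + \<rho> x\<^sub>k\<^sub>+\<^sub>1 - c \<nabla>f(x\<^sub>k\<^sub>+\<^sub>1)\<close> with
  \<open>c = (1 + \<rho>) (m + \<rho>) h\<^sup>2 / \<rho>\<close>, and the choice of \<open>y\<^sub>0\<close> says that \<open>z\<^sub>0 = x\<^sub>0\<close>. The energy
  \<open>E\<^sub>k = f(x\<^sub>k) - f\<^sup>* - h\<^sup>2 \<parallel>\<nabla>f(x\<^sub>k)\<parallel>\<^sup>2 / 2 + \<nu> \<parallel>z\<^sub>k - x\<^sup>*\<parallel>\<^sup>2 / 2\<close> with \<open>\<nu> = \<rho> / c\<close> satisfies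
  \<open>(1 + \<rho>) E\<^sub>k\<^sub>+\<^sub>1 \<le> E\<^sub>k - \<rho> (\<mu> - \<nu>) \<parallel>x\<^sub>k\<^sub>+\<^sub>1 - x\<^sup>*\<parallel>\<^sup>2 / 2\<close>, because the coefficient of
  \<open>\<parallel>\<nabla>f(x\<^sub>k\<^sub>+\<^sub>1)\<parallel>\<^sup>2\<close> that remains is \<open>(m - 2) h\<^sup>2 / 2 \<le> 0\<close>. The descent lemma gives
  \<open>f(y\<^sub>k\<^sub>+\<^sub>1) - f\<^sup>* \<le> E\<^sub>k\<close>. Since \<open>\<nu> < \<mu>\<close>, the term subtracted dominates a multiple of
  \<open>\<parallel>\<nabla>f(x\<^sub>k\<^sub>+\<^sub>1)\<parallel>\<^sup>2\<close>, which yields summability even when \<open>m = 2\<close>.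
\<close>

section \<open>Inequalities for smooth functions\<close>

text \<open>On the segment from \<open>x\<close> to \<open>y\<close>, \<open>\<phi>\<close> is, up
  to a constant, \<open>f\<close> minus its quadratic model. Cauchy-Schwarz and the Lipschitz bound
  make its derivative nonpositive.\<close>

lemma L_smooth_descent:
  fixes f :: "'a::{real_inner, complete_space} \<Rightarrow> real"
  assumes "L_smooth L f"
  shows "f y \<le> f x + grad f x \<bullet> (y - x) + L / 2 * (norm (y - x))\<^sup>2"
proof -
  define d where "d = y - x"
  define \<phi> where "\<phi> = (\<lambda>t::real. f (x + t *\<^sub>R d) - t * (grad f x \<bullet> d) - L / 2 * t\<^sup>2 * (norm d)\<^sup>2)"
  have lip: "norm (grad f u - grad f v) \<le> L * norm (u - v)" for u v
    using assms by (auto simp: L_smooth_def dest: lipschitz_onD simp flip: dist_norm)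
  have diff: "(f has_derivative (\<lambda>v. v \<bullet> grad f u)) (at u)" for u
    using assms GDERIV_grad[of f u] by (simp add: L_smooth_def gderiv_def)
  have deriv: "(\<phi> has_real_derivative
      (grad f (x + t *\<^sub>R d) - grad f x) \<bullet> d - L * t * (norm d)\<^sup>2) (at t)" for t
  proof -
    have "((\<lambda>t. x + t *\<^sub>R d) has_derivative (\<lambda>s. s *\<^sub>R d)) (at t)"
      by (auto intro!: derivative_eq_intros)
    then have "((\<lambda>t. f (x + t *\<^sub>R d)) has_derivative (\<lambda>s. (s *\<^sub>R d) \<bullet> grad f (x + t *\<^sub>R d))) (at t)"
      by (rule has_derivative_compose[OF _ diff])
    then have "((\<lambda>t. f (x + t *\<^sub>R d)) has_real_derivative d \<bullet> grad f (x + t *\<^sub>R d)) (at t)"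
      by (simp add: has_field_derivative_def mult_commute_abs)
    then show ?thesis
      unfolding \<phi>_def
      by (auto intro!: derivative_eq_intros simp: inner_diff_left inner_diff_right inner_commute)
  qed
  have "\<phi> 1 \<le> \<phi> 0"
  proof (rule DERIV_nonpos_imp_nonincreasing[of 0 1 \<phi>])
    fix t :: real assume t: "0 \<le> t" "t \<le> 1"
    have "(grad f (x + t *\<^sub>R d) - grad f x) \<bullet> d \<le> norm (grad f (x + t *\<^sub>R d) - grad f x) * norm d"
      by (rule norm_cauchy_schwarz)
    also have "\<dots> \<le> (L * norm (t *\<^sub>R d)) * norm d"
      using lip[of "x + t *\<^sub>R d" x] by (intro mult_right_mono) auto
    finally have "(grad f (x + t *\<^sub>R d) - grad f x) \<bullet> d - L * t * (norm d)\<^sup>2 \<le> 0"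
      using t by (simp add: power2_eq_square mult.assoc)
    with deriv show "\<exists>D. DERIV \<phi> t :> D \<and> D \<le> 0" by blast
  qed simp
  then show ?thesis by (simp add: \<phi>_def d_def)
qed

text \<open>The step length \<open>1 / L\<close> minimizes the quadratic upper bound along the
  negative gradient.\<close>

lemma L_smooth_gradient_step:
  fixes f :: "'a::{real_inner, complete_space} \<Rightarrow> real"
  assumes "L_smooth L f" "L > 0"
  shows "f (x - (1 / L) *\<^sub>R grad f x) \<le> f x - 1 / (2 * L) * (norm (grad f x))\<^sup>2"
proof -
  have "L / 2 * (norm ((1 / L) *\<^sub>R grad f x))\<^sup>2 = 1 / (2 * L) * (norm (grad f x))\<^sup>2"
    using assms(2) by (simp add: power_divide power2_eq_square)
  then show ?thesis
    using L_smooth_descent[OF assms(1), of "x - (1 / L) *\<^sub>R grad f x" x] assms(2)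
    by (simp flip: power2_norm_eq_inner)
qed

text \<open>A gradient step from \<open>xstar\<close> cannot go below the minimum, so the decrease
  it guarantees must vanish.\<close>

lemma L_smooth_grad_minimizer:
  fixes f :: "'a::{real_inner, complete_space} \<Rightarrow> real"
  assumes "L_smooth L f" "L > 0" "\<And>x. f xstar \<le> f x"
  shows "grad f xstar = 0"
proof -
  have "1 / (2 * L) * (norm (grad f xstar))\<^sup>2 \<le> 0"
    using L_smooth_gradient_step[OF assms(1,2), of xstar] assms(3) by (smt (verit))
  then show ?thesis using assms(2) by (simp add: divide_le_0_iff)
qed

text \<open>At an auxiliary point \<open>w\<close>, convexity at \<open>x\<close> bounds
  \<open>f w\<close> from below and the descent lemma at \<open>y\<close> bounds it from
  above.\<close>

lemma L_smooth_convex_lower_bound: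
  fixes f :: "'a::{real_inner, complete_space} \<Rightarrow> real"
  assumes smooth: "L_smooth L f" and "L > 0"
    and convex: "\<And>u v. f u + grad f u \<bullet> (v - u) \<le> f v"
  shows "f x + grad f x \<bullet> (y - x) + 1 / (2 * L) * (norm (grad f y - grad f x))\<^sup>2 \<le> f y"
proof -
  define g where "g = grad f y - grad f x"
  \<comment> \<open>This is the gradient step from \<open>y\<close> for the tilted function
    \<open>\<lambda>v. f v - grad f x \<bullet> v\<close>, which \<open>x\<close> minimizes.\<close>
  define w where "w = y - (1 / L) *\<^sub>R g"
  have "f w \<le> f y + grad f y \<bullet> (w - y) + L / 2 * (norm (w - y))\<^sup>2"
    by (rule L_smooth_descent[OF smooth])
  also have "L / 2 * (norm (w - y))\<^sup>2 = 1 / (2 * L) * (norm g)\<^sup>2"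
    using \<open>L > 0\<close> by (simp add: w_def power_mult_distrib field_simps power2_eq_square)
  finally have "f x + grad f x \<bullet> (w - x) \<le> f y + grad f y \<bullet> (w - y) + 1 / (2 * L) * (norm g)\<^sup>2"
    using convex[of x w] by simp
  moreover have "grad f y \<bullet> (w - y) - grad f x \<bullet> (w - x) = - (grad f x \<bullet> (y - x)) - 1 / L * (norm g)\<^sup>2"
    by (simp add: w_def g_def power2_norm_eq_inner inner_diff_left inner_diff_right algebra_simps
        inner_commute diff_divide_distrib add_divide_distrib)
  ultimately show ?thesis by (simp add: g_def)
qed

section \<open>Decrease of the energy\<close>

text \<open>Expand the square of the step, drop the term
  \<open>- \<rho> * (norm (z - x))\<^sup>2\<close>, and divide by \<open>1 + \<rho>\<close>.\<close>

lemma norm_sq_averaged_step_le: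
  fixes x z z' g :: "'a::real_inner"
  assumes step: "(1 + \<rho>) *\<^sub>R z' = z + \<rho> *\<^sub>R x - c *\<^sub>R g" and "\<rho> > 0"
  shows "(1 + \<rho>) * (norm z')\<^sup>2 - (norm z)\<^sup>2
    \<le> \<rho> * (norm x)\<^sup>2 - 2 * c * (g \<bullet> x) - 2 * c / (1 + \<rho>) * (g \<bullet> (z - x)) + c\<^sup>2 / (1 + \<rho>) * (norm g)\<^sup>2"
    (is "_ \<le> ?rhs")
proof -
  have "(1 + \<rho>)\<^sup>2 * (norm z')\<^sup>2 = (norm ((1 + \<rho>) *\<^sub>R z'))\<^sup>2"
    by (simp add: power_mult_distrib)
  also have "\<dots> = (norm (z + \<rho> *\<^sub>R x - c *\<^sub>R g))\<^sup>2"
    by (simp only: step)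
  also have "\<dots> = (1 + \<rho>) * (norm z)\<^sup>2 + (1 + \<rho>) * \<rho> * (norm x)\<^sup>2 - \<rho> * (norm (z - x))\<^sup>2
      - 2 * c * (1 + \<rho>) * (g \<bullet> x) - 2 * c * (g \<bullet> (z - x)) + c\<^sup>2 * (norm g)\<^sup>2"
    unfolding power2_norm_eq_inner by (simp add: algebra_simps inner_commute power2_eq_square)
  finally have "(1 + \<rho>) * ((1 + \<rho>) * (norm z')\<^sup>2 - (norm z)\<^sup>2)
      \<le> (1 + \<rho>) * \<rho> * (norm x)\<^sup>2 - 2 * c * (1 + \<rho>) * (g \<bullet> x) - 2 * c * (g \<bullet> (z - x)) + c\<^sup>2 * (norm g)\<^sup>2"
    using \<open>\<rho> > 0\<close> by (simp add: power2_eq_square right_diff_distrib mult.assoc)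
  also have "\<dots> = (1 + \<rho>) * ?rhs"
    using \<open>\<rho> > 0\<close> by (simp add: distrib_left right_diff_distrib) (simp add: algebra_simps)
  finally show ?thesis
    using \<open>\<rho> > 0\<close> by simp
qed

text \<open>Three bounds are added: the smooth convex lower bound between \<open>x\<close> and
  \<open>x'\<close>, \<open>\<rho>\<close> times strong convexity between \<open>x'\<close> and
  \<open>u\<close>, and the averaged step for \<open>z'\<close>. As
  \<open>\<nu> * c = \<rho>\<close>, their terms in \<open>g \<bullet> (z - x')\<close> and
  \<open>g \<bullet> (x' - u)\<close> cancel.\<close>

lemma energy_step:
  fixes f :: "'a::{real_inner, complete_space} \<Rightarrow> real"
  assumes convex: "strongly_convex \<mu> f" and smooth: "L_smooth L f"
    and pos: "\<mu> > 0" "L > 0" "\<rho> > 0" and m: "0 < m" "m \<le> 2"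
    and c: "c = (1 + \<rho>) * (m + \<rho>) / (\<rho> * L)" and \<nu>: "\<nu> = \<rho> / c"
    and x: "(1 + \<rho>) *\<^sub>R (x' - (x - (1 / L) *\<^sub>R grad f x)) = \<rho> *\<^sub>R (z - x')"
    and z: "(1 + \<rho>) *\<^sub>R z' = z + \<rho> *\<^sub>R x' - c *\<^sub>R grad f x'"
  shows "(1 + \<rho>) * (f x' - f u - 1 / (2 * L) * (norm (grad f x'))\<^sup>2 + \<nu> / 2 * (norm (z' - u))\<^sup>2)
    \<le> f x - f u - 1 / (2 * L) * (norm (grad f x))\<^sup>2 + \<nu> / 2 * (norm (z - u))\<^sup>2
      - \<rho> * (\<mu> - \<nu>) / 2 * (norm (x' - u))\<^sup>2"
proof -
  define g where "g = grad f x'"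
  have c0: "c > 0" using c pos m by simp
  have \<nu>0: "\<nu> > 0" and \<nu>c: "\<nu> * c = \<rho>" using \<nu> c0 pos by simp_all
  have sc: "f v + grad f v \<bullet> (w - v) + \<mu> / 2 * (norm (v - w))\<^sup>2 \<le> f w" for v w
    using convex by (simp add: strongly_convex_def)
  have "f v + grad f v \<bullet> (w - v) \<le> f w" for v w
    using sc[of v w] pos by (smt (verit) divide_nonneg_nonneg mult_nonneg_nonneg zero_le_power2)
  then have lower: "f x' + g \<bullet> (x - x') + 1 / (2 * L) * (norm (grad f x - g))\<^sup>2 \<le> f x"
    unfolding g_def by (rule L_smooth_convex_lower_bound[OF smooth \<open>L > 0\<close>])
  have x'': "x - (1 / L) *\<^sub>R grad f x - x' = - (\<rho> / (1 + \<rho>)) *\<^sub>R (z - x')"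
  proof -
    have "(1 + \<rho>) *\<^sub>R (x - (1 / L) *\<^sub>R grad f x - x')
        = - ((1 + \<rho>) *\<^sub>R (x' - (x - (1 / L) *\<^sub>R grad f x)))"
      by (simp flip: scaleR_minus_right)
    also have "\<dots> = (1 + \<rho>) *\<^sub>R (- (\<rho> / (1 + \<rho>)) *\<^sub>R (z - x'))"
      unfolding x using pos by simp
    finally have "(1 + \<rho>) *\<^sub>R (x - (1 / L) *\<^sub>R grad f x - x')
        = (1 + \<rho>) *\<^sub>R (- (\<rho> / (1 + \<rho>)) *\<^sub>R (z - x'))" .
    then show ?thesis using pos by (simp only: scaleR_cancel_left) simp
  qed
  \<comment> \<open>The cross term of the expanded square replaces \<open>x\<close> by its gradient
    step, to which the coupling applies.\<close>
  have "f x - 1 / (2 * L) * (norm (grad f x))\<^sup>2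
      \<ge> f x' + g \<bullet> (x - (1 / L) *\<^sub>R grad f x - x') + 1 / (2 * L) * (norm g)\<^sup>2"
    using lower by (simp add: power2_norm_eq_inner inner_diff_left inner_diff_right inner_commute
        add_divide_distrib diff_divide_distrib)
  then have lower': "f x - 1 / (2 * L) * (norm (grad f x))\<^sup>2
      \<ge> f x' - \<rho> / (1 + \<rho>) * (g \<bullet> (z - x')) + 1 / (2 * L) * (norm g)\<^sup>2"
    unfolding x'' by simp
  have star: "f x' - f u \<le> g \<bullet> (x' - u) - \<mu> / 2 * (norm (x' - u))\<^sup>2"
    using sc[of x' u] by (simp add: g_def inner_diff_right)
  have "(1 + \<rho>) *\<^sub>R (z' - u) = (z - u) + \<rho> *\<^sub>R (x' - u) - c *\<^sub>R g"
    using z by (simp add: g_def algebra_simps)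
  from norm_sq_averaged_step_le[OF this \<open>\<rho> > 0\<close>]
  have "\<nu> / 2 * ((1 + \<rho>) * (norm (z' - u))\<^sup>2 - (norm (z - u))\<^sup>2)
      \<le> \<nu> / 2 * (\<rho> * (norm (x' - u))\<^sup>2 - 2 * c * (g \<bullet> (x' - u))
          - 2 * c / (1 + \<rho>) * (g \<bullet> (z - x')) + c\<^sup>2 / (1 + \<rho>) * (norm g)\<^sup>2)"
    using \<nu>0 by (intro mult_left_mono) simp_all
  also have "\<dots> = \<nu> * \<rho> / 2 * (norm (x' - u))\<^sup>2 - (\<nu> * c) * (g \<bullet> (x' - u))
      - (\<nu> * c) / (1 + \<rho>) * (g \<bullet> (z - x')) + (\<nu> * c) * c / (2 * (1 + \<rho>)) * (norm g)\<^sup>2"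
    by (simp add: algebra_simps power2_eq_square)
  also have "(\<nu> * c) * c / (2 * (1 + \<rho>)) = (m + \<rho>) / (2 * L)"
  proof -
    have "\<rho> * c = (1 + \<rho>) * ((m + \<rho>) / L)" using pos by (simp add: c)
    then show ?thesis unfolding \<nu>c using pos by (simp add: field_simps)
  qed
  finally have dist: "\<nu> / 2 * ((1 + \<rho>) * (norm (z' - u))\<^sup>2 - (norm (z - u))\<^sup>2)
      \<le> \<nu> * \<rho> / 2 * (norm (x' - u))\<^sup>2 - \<rho> * (g \<bullet> (x' - u))
      - \<rho> / (1 + \<rho>) * (g \<bullet> (z - x')) + (m + \<rho>) / (2 * L) * (norm g)\<^sup>2"
    unfolding \<nu>c .
  have "\<rho> * (f x' - f u) \<le> \<rho> * (g \<bullet> (x' - u) - \<mu> / 2 * (norm (x' - u))\<^sup>2)"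
    using star pos by (intro mult_left_mono) simp_all
  \<comment> \<open>Here \<open>m \<le> 2\<close> enters. Of the weight \<open>2 + \<rho>\<close>,
    the part \<open>1 + \<rho>\<close> comes from the new energy and \<open>1\<close> from
    \<open>lower'\<close>.\<close>
  moreover have "(m + \<rho>) / (2 * L) * (norm g)\<^sup>2 \<le> (2 + \<rho>) * (1 / (2 * L) * (norm g)\<^sup>2)"
    using pos m by (simp add: divide_right_mono mult_right_mono)
  ultimately show ?thesis
    using lower' dist unfolding g_def[symmetric]
    by (simp add: algebra_simps diff_divide_distrib add_divide_distrib)
qed

text \<open>Multiplied by \<open>\<theta> ^ k\<close>, the step inequality telescopes.\<close>

lemma geometric_decay:
  fixes E r :: "nat \<Rightarrow> real"
  assumes "\<theta> > 0" and step: "\<And>k. \<theta> * E (Suc k) \<le> E k - r k"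
    and r: "\<And>k. 0 \<le> r k"
  shows "\<theta> ^ n * E n \<le> E 0" and "(\<Sum>k<n. \<theta> ^ k * r k) \<le> E 0 - \<theta> ^ n * E n"
proof -
  show sum: "(\<Sum>k<n. \<theta> ^ k * r k) \<le> E 0 - \<theta> ^ n * E n"
  proof (induction n)
    case (Suc n)
    have "\<theta> ^ n * (\<theta> * E (Suc n)) \<le> \<theta> ^ n * (E n - r n)"
      using step \<open>\<theta> > 0\<close> by (intro mult_left_mono) simp_all
    with Suc show ?case by (simp add: algebra_simps)
  qed simp
  have "0 \<le> (\<Sum>k<n. \<theta> ^ k * r k)"
    using r \<open>\<theta> > 0\<close> by (intro sum_nonneg mult_nonneg_nonneg) simp_all
  with sum show "\<theta> ^ n * E n \<le> E 0" by linarith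
qed

section \<open>Convergence of the iteration\<close>

theorem theorem10:
  fixes f :: "'a::{real_inner, complete_space} \<Rightarrow> real"
    and \<mu> L m h \<alpha> \<gamma> \<rho> q fstar :: real
    and xstar :: 'a
    and x y :: "nat \<Rightarrow> 'a"
  assumes "\<mu> > 0" and "L > 0"
    and "strongly_convex \<mu> f" and "L_smooth L f"
    and "is_arg_min f (\<lambda>_. True) xstar" and "fstar = f xstar"
    and "m \<in> {1..2}"
    and "h = 1 / sqrt L" and "\<alpha> = 2 * sqrt (\<mu> * m)" and "\<gamma> = m + \<alpha> * h"
    and "q = \<mu> / L" and "\<rho> = sqrt (q * m)"
    and "\<And>k. y (Suc k) = x k - h\<^sup>2 *\<^sub>R grad f (x k)"
    and "\<And>k. x (Suc k) = y (Suc k) + (1 / (1 + \<alpha> * h)) *\<^sub>R (y (Suc k) - y k)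
            + (\<gamma> / (1 + \<alpha> * h) - 1) *\<^sub>R (y (Suc k) - x k)"
    and "y 0 = - ((\<gamma> - 1 / 2 * \<alpha> * h) * h\<^sup>2) *\<^sub>R grad f (x 0) + x 0"
  shows "(\<forall>k\<ge>1. f (y k) - fstar
            \<le> (\<mu> / 2 * (norm (x 0 - xstar))\<^sup>2 + (f (x 0) - fstar)) * (1 + \<rho>) powi (- int k + 1))
    \<and> summable (\<lambda>k. (1 + \<rho>) ^ k * (norm (grad f (x k)))\<^sup>2)
    \<and> (\<lambda>k. (norm (grad f (x k)))\<^sup>2) \<in> o(\<lambda>k. (1 + \<rho>) powi (- int k))"
proof -
  note pos = assms(1,2) and convex = assms(3) and smooth = assms(4)
  have fmin: "fstar \<le> f u" for u
    using assms(5,6) by (simp add: is_arg_min_linorder)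
  have m: "1 \<le> m" "m \<le> 2" using assms(7) by auto
  have h2: "h\<^sup>2 = 1 / L" using assms(8) pos by (simp add: power_divide)
  have \<rho>0: "\<rho> > 0" using pos m assms(11,12) by simp
  have \<rho>2: "\<rho>\<^sup>2 = \<mu> * m / L" using pos m assms(11,12) by simp
  have \<alpha>h: "\<alpha> * h = 2 * \<rho>"
    using assms(8,9,11,12) by (simp add: real_sqrt_divide)
  define G where "G = (\<lambda>k. grad f (x k))"
  define z where "z = (\<lambda>k. x k + (1 / \<rho>) *\<^sub>R (x k - y k - ((m + \<rho>) / L) *\<^sub>R G k))"
  define c where "c = (1 + \<rho>) * (m + \<rho>) / (\<rho> * L)"
  define \<nu> where "\<nu> = \<rho> / c"
  define E where "E = (\<lambda>k. f (x k) - fstar - 1 / (2 * L) * (norm (G k))\<^sup>2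
    + \<nu> / 2 * (norm (z k - xstar))\<^sup>2)"
  have y: "y (Suc k) = x k - (1 / L) *\<^sub>R G k" for k
    using assms(13) by (simp add: h2 G_def)
  \<comment> \<open>Both \<open>x (Suc k)\<close> and \<open>z k\<close> are
    \<open>y (Suc k)\<close> plus a multiple of \<open>w k\<close>, so the coupling
    \<open>xz\<close> reduces to a scalar identity.\<close>
  define w where "w = (\<lambda>k. x k - y k - (m / L) *\<^sub>R G k)"
  have x: "x (Suc k) = y (Suc k) + (1 / (1 + 2 * \<rho>)) *\<^sub>R w k" for k
  proof -
    have "\<gamma> / (1 + 2 * \<rho>) - 1 = (1 / (1 + 2 * \<rho>)) * (m - 1)"
      using \<rho>0 by (simp add: assms(10) \<alpha>h field_simps)
    then have "x (Suc k) = y (Suc k) + (1 / (1 + 2 * \<rho>)) *\<^sub>R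
        ((y (Suc k) - y k) + (m - 1) *\<^sub>R (y (Suc k) - x k))"
      using assms(14)[of k] unfolding \<alpha>h by (simp add: scaleR_add_right add.assoc)
    also have "(y (Suc k) - y k) + (m - 1) *\<^sub>R (y (Suc k) - x k) = w k"
      by (simp add: y w_def algebra_simps diff_divide_distrib)
    finally show ?thesis .
  qed
  have zw: "z k = y (Suc k) + (1 / \<rho>) *\<^sub>R w k" for k
    using \<rho>0 by (simp add: z_def w_def y algebra_simps add_divide_distrib)
  have xz: "(1 + \<rho>) *\<^sub>R (x (Suc k) - (x k - (1 / L) *\<^sub>R grad f (x k))) = \<rho> *\<^sub>R (z k - x (Suc k))" for k
  proof -
    have "(1 + \<rho>) * (1 / (1 + 2 * \<rho>)) = \<rho> * (1 / \<rho> - 1 / (1 + 2 * \<rho>))"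
      using \<rho>0 by (simp add: divide_simps)
    then have "(1 + \<rho>) *\<^sub>R ((1 / (1 + 2 * \<rho>)) *\<^sub>R w k) = \<rho> *\<^sub>R ((1 / \<rho>) *\<^sub>R w k - (1 / (1 + 2 * \<rho>)) *\<^sub>R w k)"
      by (simp only: scaleR_scaleR flip: scaleR_diff_left)
    moreover have "x (Suc k) - (x k - (1 / L) *\<^sub>R grad f (x k)) = (1 / (1 + 2 * \<rho>)) *\<^sub>R w k"
      using x[of k] y[of k] by (simp add: G_def)
    moreover have "z k - x (Suc k) = (1 / \<rho>) *\<^sub>R w k - (1 / (1 + 2 * \<rho>)) *\<^sub>R w k"
      unfolding zw x by simp
    ultimately show ?thesis by simp
  qed
  have zz: "(1 + \<rho>) *\<^sub>R z (Suc k) = z k + \<rho> *\<^sub>R x (Suc k) - c *\<^sub>R grad f (x (Suc k))" for k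
  proof -
    \<comment> \<open>This is \<open>xz\<close> divided by \<open>\<rho>\<close>; \<open>c\<close>
      is \<open>1 + \<rho>\<close> times the weight of \<open>G\<close> in \<open>z\<close>.\<close>
    have "(1 + \<rho>) *\<^sub>R ((1 / \<rho>) *\<^sub>R (x (Suc k) - y (Suc k))) = z k - x (Suc k)"
    proof -
      have "(1 + \<rho>) *\<^sub>R (x (Suc k) - y (Suc k)) = \<rho> *\<^sub>R (z k - x (Suc k))"
        using xz[of k] y[of k] by (simp add: G_def)
      then have "(1 / \<rho>) *\<^sub>R ((1 + \<rho>) *\<^sub>R (x (Suc k) - y (Suc k))) = z k - x (Suc k)"
        using \<rho>0 by simp
      then show ?thesis by (simp add: mult.commute)
    qed
    moreover have "(1 + \<rho>) *\<^sub>R z (Suc k) = (1 + \<rho>) *\<^sub>R x (Suc k)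
        + (1 + \<rho>) *\<^sub>R ((1 / \<rho>) *\<^sub>R (x (Suc k) - y (Suc k))) - c *\<^sub>R G (Suc k)"
      by (simp add: z_def c_def scaleR_add_right scaleR_diff_right)
    ultimately show ?thesis by (simp only: G_def) (simp add: algebra_simps)
  qed
  \<comment> \<open>The factor \<open>\<gamma> - \<alpha> * h / 2\<close> equals
    \<open>m + \<rho>\<close>.\<close>
  have "x 0 - y 0 = ((m + \<rho>) / L) *\<^sub>R G 0"
    using assms(15) by (simp add: assms(10) \<alpha>h h2 G_def)
  then have z0: "z 0 = x 0" by (simp add: z_def)
  have "\<nu> = \<rho>\<^sup>2 * L / ((1 + \<rho>) * (m + \<rho>))"
    by (simp add: \<nu>_def c_def power2_eq_square)
  also have "\<dots> = \<mu> * (m / ((1 + \<rho>) * (m + \<rho>)))"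
    using pos by (simp add: \<rho>2)
  also have "\<dots> < \<mu> * 1"
  proof -
    have "m < (1 + \<rho>) * (m + \<rho>)"
      using \<rho>0 m by (simp add: algebra_simps add_pos_pos)
    then show ?thesis using pos \<rho>0 m by (intro mult_strict_left_mono) simp_all
  qed
  finally have \<nu>\<mu>: "\<nu> < \<mu>" by simp
  have \<nu>0: "\<nu> > 0" using \<rho>0 m pos by (simp add: \<nu>_def c_def)
  \<comment> \<open>Chosen so that \<open>\<kappa> * L\<^sup>2\<close> is the coefficient of the
    slack in \<open>energy_step\<close>.\<close>
  define \<kappa> where "\<kappa> = \<rho> * (\<mu> - \<nu>) / (2 * L\<^sup>2)"
  have \<kappa>0: "\<kappa> > 0" using \<rho>0 \<nu>\<mu> pos by (simp add: \<kappa>_def)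
  have grad_le: "(norm (G k))\<^sup>2 \<le> L\<^sup>2 * (norm (x k - xstar))\<^sup>2" for k
  proof -
    have "grad f xstar = 0"
      using L_smooth_grad_minimizer[OF smooth] pos fmin assms(6) by blast
    moreover have "norm (G k - grad f xstar) \<le> L * norm (x k - xstar)"
      using smooth by (auto simp: G_def L_smooth_def dest: lipschitz_onD simp flip: dist_norm)
    ultimately have "(norm (G k))\<^sup>2 \<le> (L * norm (x k - xstar))\<^sup>2"
      by (intro power_mono) simp_all
    then show ?thesis by (simp add: power_mult_distrib)
  qed
  have step: "(1 + \<rho>) * E (Suc k) \<le> E k - \<kappa> * (norm (G (Suc k)))\<^sup>2" for k
  proof -
    have "\<kappa> * (norm (G (Suc k)))\<^sup>2 \<le> \<kappa> * (L\<^sup>2 * (norm (x (Suc k) - xstar))\<^sup>2)"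
      using grad_le \<kappa>0 by (intro mult_left_mono) simp_all
    also have "\<dots> = \<rho> * (\<mu> - \<nu>) / 2 * (norm (x (Suc k) - xstar))\<^sup>2"
      using pos by (simp add: \<kappa>_def)
    finally show ?thesis
      using energy_step[OF convex smooth pos \<rho>0 _ m(2) c_def \<nu>_def xz[of k] zz[of k], of xstar] m
      unfolding E_def assms(6) G_def by linarith
  qed
  have fE: "f (y (Suc k)) - fstar \<le> E k" for k
  proof -
    have "0 \<le> \<nu> / 2 * (norm (z k - xstar))\<^sup>2" using \<nu>0 by simp
    then show ?thesis
      using L_smooth_gradient_step[OF smooth \<open>L > 0\<close>, of "x k"] unfolding E_def y G_def by linarith
  qed
  \<comment> \<open>The gradient term of \<open>E\<close> is negative; nonnegativity comes from the
    next gradient step staying above the minimum.\<close>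
  have E_nonneg: "0 \<le> E k" for k using fE[of k] fmin[of "y (Suc k)"] by linarith
  define B where "B = \<mu> / 2 * (norm (x 0 - xstar))\<^sup>2 + (f (x 0) - fstar)"
  have "\<nu> / 2 * (norm (x 0 - xstar))\<^sup>2 \<le> \<mu> / 2 * (norm (x 0 - xstar))\<^sup>2"
    using \<nu>\<mu> by (intro mult_right_mono) simp_all
  moreover have "0 \<le> 1 / (2 * L) * (norm (G 0))\<^sup>2" using pos by simp
  ultimately have E0: "E 0 \<le> B" unfolding E_def z0 B_def by linarith
  have decay: "(1 + \<rho>) ^ n * E n \<le> E 0"
    and sums: "(\<Sum>k<n. (1 + \<rho>) ^ k * (\<kappa> * (norm (G (Suc k)))\<^sup>2)) \<le> E 0 - (1 + \<rho>) ^ n * E n" for n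
    using \<rho>0 \<kappa>0 step
    by (intro geometric_decay[where E = E and r = "\<lambda>k. \<kappa> * (norm (G (Suc k)))\<^sup>2"]; simp)+
  have rate: "f (y k) - fstar \<le> B * (1 + \<rho>) powi (- int k + 1)" if "k \<ge> 1" for k
  proof -
    \<comment> \<open>\<open>E j\<close> controls \<open>y (Suc j)\<close>, whence the exponent
      \<open>- k + 1\<close>.\<close>
    obtain j where k: "k = Suc j" using \<open>k \<ge> 1\<close> by (cases k) auto
    have "f (y k) - fstar \<le> E j" using fE k by simp
    also have "\<dots> \<le> B / (1 + \<rho>) ^ j"
      using decay[of j] E0 \<rho>0 by (simp add: pos_le_divide_eq mult.commute)
    also have "\<dots> = B * (1 + \<rho>) powi (- int k + 1)"
      by (simp add: k power_int_minus divide_inverse)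
    finally show ?thesis .
  qed
  have summ: "summable (\<lambda>k. (1 + \<rho>) ^ k * (norm (G k))\<^sup>2)"
  proof -
    have "summable (\<lambda>k. (1 + \<rho>) ^ k * (\<kappa> * (norm (G (Suc k)))\<^sup>2))"
    proof (rule summableI_nonneg_bounded)
      show "(\<Sum>k<n. (1 + \<rho>) ^ k * (\<kappa> * (norm (G (Suc k)))\<^sup>2)) \<le> E 0" for n
        using sums[of n] E_nonneg[of n] \<rho>0 by (smt (verit) mult_nonneg_nonneg zero_le_power)
    qed (use \<rho>0 \<kappa>0 in simp)
    then have "summable (\<lambda>k. (1 + \<rho>) / \<kappa> * ((1 + \<rho>) ^ k * (\<kappa> * (norm (G (Suc k)))\<^sup>2)))"
      by (rule summable_mult)
    \<comment> \<open>The slack sees gradients only from index 1 on; the factor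
      \<open>1 + \<rho>\<close> aligns the exponent for the shift.\<close>
    then have "summable (\<lambda>k. (1 + \<rho>) ^ Suc k * (norm (G (Suc k)))\<^sup>2)"
      using \<kappa>0 by (simp add: mult.assoc)
    then show ?thesis by (subst (asm) summable_Suc_iff)
  qed
  have "(\<lambda>k. (norm (G k))\<^sup>2) \<in> o(\<lambda>k. (1 + \<rho>) powi (- int k))"
  proof (rule smalloI_tendsto)
    have "(norm (G k))\<^sup>2 / (1 + \<rho>) powi (- int k) = (1 + \<rho>) ^ k * (norm (G k))\<^sup>2" for k
      by (simp add: power_int_minus divide_inverse mult.commute)
    then show "(\<lambda>k. (norm (G k))\<^sup>2 / (1 + \<rho>) powi (- int k)) \<longlonglongrightarrow> 0"
      using summable_LIMSEQ_zero[OF summ] by simp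
  qed (use \<rho>0 in simp)
  with rate summ show ?thesis unfolding B_def G_def by blast
qed

end
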